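(* Let $\mathrm{a}_{n,k}^{\mathrm{pk}}(123,132)$ denote the number of permutations of $\{1,\dots,n\}$ that avoid both $123$ and $132$ and have exactly $k$ peaks. Then for all integers $n\ge1$ and $k\ge0$, $$\mathrm{a}_{n,k}^{\mathrm{pk}}(123,132)=\binom{n}{2k+1}.$$
   Context: $\mathcal{S}_n$ is the set of permutations $\pi=\pi_1\cdots\pi_n$ of $\{1,\dots,n\}$. For $\rho\in\mathcal{S}_m$, $\pi\in\mathcal{S}_n$ contains $\rho$ if there are indices $1\le i_1<\cdots<i_m\le n$ such that $\pi_{i_a}<\pi_{i_b}$ if and only if $\rho_a<\rho_b$; otherwise $\pi$ avoids $\rho$. The number of peaks is $\mathrm{pk}(\pi)=|\{i:\pi_i<\pi_{i+1}\text{ and }\pi_{i+1}>\pi_{i+2}\}|$, where $1\le i\le n-2$. Binomial coefficients $\binom{m}{j}$ with $j>m\ge 0$ are $0$. *)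

theory Defs
  imports "HOL-Combinatorics.Multiset_Permutations"
begin

(* A permutation of {1..n} is given by its one-line notation, i.e. as an element of
   permutations_of_set {1..n}.  List positions start at 0, so the entry written
   with index i + 1 on paper is xs ! i. *)

definition contains_pattern :: "nat list \<Rightarrow> nat list \<Rightarrow> bool" where
  "contains_pattern xs \<rho> \<longleftrightarrow>
     (\<exists>f. strict_mono_on {..<length \<rho>} f \<and> f ` {..<length \<rho>} \<subseteq> {..<length xs} \<and>
          (\<forall>a<length \<rho>. \<forall>b<length \<rho>. xs ! f a < xs ! f b \<longleftrightarrow> \<rho> ! a < \<rho> ! b))"

definition avoids_pattern :: "nat list \<Rightarrow> nat list \<Rightarrow> bool" where
  "avoids_pattern xs \<rho> \<longleftrightarrow> \<not> contains_pattern xs \<rho>"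

definition pk :: "nat list \<Rightarrow> nat" where
  "pk xs = card {i. i + 2 < length xs \<and> xs ! i < xs ! (i + 1) \<and> xs ! (i + 1) > xs ! (i + 2)}"

definition a_pk :: "nat list set \<Rightarrow> nat \<Rightarrow> nat \<Rightarrow> nat" where
  "a_pk P n k =
     card {xs \<in> permutations_of_set {1..n}. (\<forall>\<rho>\<in>P. avoids_pattern xs \<rho>) \<and> pk xs = k}"

end

theory Submission
  imports Defs
begin

text \<open>
  Avoiding 123 and 132 means that every entry has at most one larger entry to its right, so the
  first entry of such a permutation is the largest or the second largest value and the rest is
  again of this form.  Prepending the largest value creates no peak.  Prepending the second largest
  one creates a peak exactly when the rest starts with its maximum and has length at least 2.
  Counting separately the permutations that start with their maximum and the others gives
  \<open>n - 1 choose (2 * k + 1)\<close> and \<open>n - 1 choose (2 * k)\<close> for \<open>n \<ge> 2\<close>, by Pascal's rule.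
\<close>

section \<open>Avoidance of 123 and 132 as a bound on larger entries to the right\<close>

lemma strict_mono_on_lessThan_3:
  fixes f :: "nat \<Rightarrow> nat"
  shows "strict_mono_on {..<3} f \<longleftrightarrow> f 0 < f 1 \<and> f 1 < f 2"
  by (auto simp: strict_mono_on_def numeral_3_eq_3 numeral_2_eq_2 less_Suc_eq)

text \<open>An embedding of three positions amounts to its three values, and conversely
  \<open>(!) [i, j, k]\<close> serves as the embedding. Leaving \<open>a\<close>, \<open>b\<close>,
  \<open>c\<close> open covers both patterns at once.\<close>

lemma contains_pattern_length_3:
  "contains_pattern xs [a, b, c] \<longleftrightarrow>
     (\<exists>i j k. i < j \<and> j < k \<and> k < length xs \<and>
        (\<forall>u<3. \<forall>v<3. xs ! ([i, j, k] ! u) < xs ! ([i, j, k] ! v) \<longleftrightarrow> [a, b, c] ! u < [a, b, c] ! v))"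
  (is "?L \<longleftrightarrow> ?R")
proof
  assume ?L
  then obtain f where f: "strict_mono_on {..<3} f" "f ` {..<3} \<subseteq> {..<length xs}"
    "\<forall>u<3. \<forall>v<3. xs ! f u < xs ! f v \<longleftrightarrow> [a, b, c] ! u < [a, b, c] ! v"
    by (auto simp: contains_pattern_def numeral_3_eq_3)
  have "[f 0, f 1, f 2] ! u = f u" if "u < 3" for u
    using that by (auto simp: numeral_3_eq_3 numeral_2_eq_2 less_Suc_eq)
  moreover have "f 0 < f 1" "f 1 < f 2"
    using f(1) by (auto simp: strict_mono_on_lessThan_3)
  moreover have "f 2 < length xs"
    using f(2) by (auto simp: image_subset_iff)
  ultimately show ?R
    using f(3) by (intro exI[of _ "f 0"] exI[of _ "f 1"] exI[of _ "f 2"]) simp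
next
  assume ?R
  then obtain i j k where *: "i < j" "j < k" "k < length xs"
    "\<forall>u<3. \<forall>v<3. xs ! ([i, j, k] ! u) < xs ! ([i, j, k] ! v) \<longleftrightarrow> [a, b, c] ! u < [a, b, c] ! v"
    by blast
  show ?L
    unfolding contains_pattern_def
  proof (intro exI[of _ "(!) [i, j, k]"] conjI)
    show "strict_mono_on {..<length [a, b, c]} ((!) [i, j, k])"
      using strict_mono_on_lessThan_3[of "(!) [i, j, k]"] * by (simp add: numeral_3_eq_3)
    show "(!) [i, j, k] ` {..<length [a, b, c]} \<subseteq> {..<length xs}"
      using * by (auto simp: less_Suc_eq)
  qed (use * in \<open>auto simp: numeral_3_eq_3\<close>)
qed

text \<open>Two later entries above \<open>xs ! i\<close> are distinct, so they occur either in
  increasing order, giving 123, or in decreasing order, giving 132.\<close>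

lemma contains_123_or_132_iff:
  assumes "distinct xs"
  shows "contains_pattern xs [1, 2, 3] \<or> contains_pattern xs [1, 3, 2] \<longleftrightarrow>
    (\<exists>i j k. i < j \<and> j < k \<and> k < length xs \<and> xs ! i < xs ! j \<and> xs ! i < xs ! k)"
proof -
  have "xs ! j < xs ! k \<or> xs ! k < xs ! j" if "j < k" "k < length xs" for j k
    using that assms by (metis nat_neq_iff nth_eq_iff_index_eq order.strict_trans)
  then have tri: "(\<exists>i j k. i < j \<and> j < k \<and> k < length xs \<and> xs ! i < xs ! j \<and> xs ! i < xs ! k) \<longleftrightarrow>
      (\<exists>i j k. i < j \<and> j < k \<and> k < length xs \<and> xs ! i < xs ! j \<and> xs ! j < xs ! k) \<or>
      (\<exists>i j k. i < j \<and> j < k \<and> k < length xs \<and> xs ! i < xs ! k \<and> xs ! k < xs ! j)"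
    by (meson less_trans)
  have all_less_3: "(\<forall>u<3. P u) \<longleftrightarrow> P 0 \<and> P 1 \<and> P (2::nat)" for P
    by (auto simp: numeral_3_eq_3 numeral_2_eq_2 less_Suc_eq)
  have 1: "contains_pattern xs [1, 2, 3] \<longleftrightarrow>
      (\<exists>i j k. i < j \<and> j < k \<and> k < length xs \<and> xs ! i < xs ! j \<and> xs ! j < xs ! k)"
    unfolding contains_pattern_length_3 all_less_3 by (intro ex_cong1) auto
  have 2: "contains_pattern xs [1, 3, 2] \<longleftrightarrow>
      (\<exists>i j k. i < j \<and> j < k \<and> k < length xs \<and> xs ! i < xs ! k \<and> xs ! k < xs ! j)"
    unfolding contains_pattern_length_3 all_less_3 by (intro ex_cong1) auto
  show ?thesis
    unfolding tri 1 2 ..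
qed

text \<open>The recursive form lets permutations be counted by removing the first entry.\<close>

fun few_larger_right :: "nat list \<Rightarrow> bool" where
  "few_larger_right [] \<longleftrightarrow> True"
| "few_larger_right (x # xs) \<longleftrightarrow> card {y \<in> set xs. x < y} \<le> 1 \<and> few_larger_right xs"

text \<open>Passes from values to positions: in a distinct list, two different values are the same
  thing as two different positions.\<close>

lemma card_set_le_1_iff:
  assumes "distinct xs"
  shows "card {y \<in> set xs. P y} \<le> 1 \<longleftrightarrow> \<not> (\<exists>j k. j < k \<and> k < length xs \<and> P (xs ! j) \<and> P (xs ! k))"
proof -
  have "card {y \<in> set xs. P y} \<le> 1 \<longleftrightarrow> (\<forall>y\<in>set xs. \<forall>z\<in>set xs. P y \<longrightarrow> P z \<longrightarrow> y = z)"
    by (auto simp: card_le_Suc0_iff_eq)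
  also have "\<dots> \<longleftrightarrow> (\<forall>j<length xs. \<forall>k<length xs. P (xs ! j) \<longrightarrow> P (xs ! k) \<longrightarrow> j = k)"
    using assms by (auto simp: all_set_conv_all_nth nth_eq_iff_index_eq)
  also have "\<dots> \<longleftrightarrow> \<not> (\<exists>j k. j < k \<and> k < length xs \<and> P (xs ! j) \<and> P (xs ! k))" (is "?A \<longleftrightarrow> ?B")
  proof
    assume ?A
    show ?B
    proof
      assume "\<exists>j k. j < k \<and> k < length xs \<and> P (xs ! j) \<and> P (xs ! k)"
      then obtain j k where "j < k" "k < length xs" "P (xs ! j)" "P (xs ! k)" by blast
      with \<open>?A\<close> show False by (metis less_trans less_irrefl)
    qed
  next
    assume ?B
    then show ?A by (blast intro: linorder_cases)
  qed
  finally show ?thesis .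
qed

text \<open>Splitting the least index into \<open>0\<close> and \<open>Suc i\<close> mirrors the
  recursion: the head yields the cardinality bound, the tail the induction hypothesis.\<close>

lemma few_larger_right_iff:
  assumes "distinct xs"
  shows "few_larger_right xs \<longleftrightarrow>
    \<not> (\<exists>i j k. i < j \<and> j < k \<and> k < length xs \<and> xs ! i < xs ! j \<and> xs ! i < xs ! k)"
  using assms
proof (induction xs)
  case (Cons x xs)
  let ?Q = "\<lambda>xs i j k. i < j \<and> j < k \<and> k < length xs \<and> xs ! i < xs ! j \<and> xs ! i < (xs ! k :: nat)"
  have ex_nat: "(\<exists>i. R i) \<longleftrightarrow> R 0 \<or> (\<exists>i. R (Suc i))" for R
    by (metis not0_implies_Suc)
  have "(\<exists>i j k. ?Q (x # xs) i j k) \<longleftrightarrow>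
    (\<exists>j k. ?Q (x # xs) 0 j k) \<or> (\<exists>i j k. ?Q (x # xs) (Suc i) j k)"
    by (rule ex_nat)
  also have "(\<exists>j k. ?Q (x # xs) 0 j k) \<longleftrightarrow>
      (\<exists>j k. j < k \<and> k < length xs \<and> x < xs ! j \<and> x < xs ! k)" (is "?A \<longleftrightarrow> ?B")
  proof
    assume ?A
    then obtain j k where "?Q (x # xs) 0 j k" by blast
    then show ?B by (cases j; cases k) auto
  next
    assume ?B
    then obtain j k where "?Q (x # xs) 0 (Suc j) (Suc k)" by auto
    then show ?A by blast
  qed
  also have "(\<exists>i j k. ?Q (x # xs) (Suc i) j k) \<longleftrightarrow> (\<exists>i j k. ?Q xs i j k)" (is "?A \<longleftrightarrow> ?B")
  proof
    assume ?A
    then obtain i j k where "?Q (x # xs) (Suc i) j k" by blast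
    then show ?B by (cases j; cases k) auto
  next
    assume ?B
    then obtain i j k where "?Q (x # xs) (Suc i) (Suc j) (Suc k)" by auto
    then show ?A by blast
  qed
  finally have "(\<exists>i j k. ?Q (x # xs) i j k) \<longleftrightarrow> \<not> card {y \<in> set xs. x < y} \<le> 1 \<or> (\<exists>i j k. ?Q xs i j k)"
    using Cons.prems by (simp only: card_set_le_1_iff distinct.simps not_not)
  moreover have "few_larger_right xs \<longleftrightarrow> \<not> (\<exists>i j k. ?Q xs i j k)"
    using Cons by simp
  ultimately show ?case
    unfolding few_larger_right.simps by blast
qed simp

section \<open>Peaks after prepending an entry\<close>

lemma pk_Nil [simp]: "pk [] = 0"
  by (simp add: pk_def)

text \<open>Old peaks shift by one position, so only index \<open>0\<close> can be new. The length
  condition guards \<open>hd xs\<close> and \<open>xs ! 1\<close>.\<close>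

lemma pk_Cons:
  "pk (x # xs) = pk xs + (if 2 \<le> length xs \<and> x < hd xs \<and> xs ! 1 < hd xs then 1 else 0)"
proof -
  let ?P = "\<lambda>xs. {i. i + 2 < length xs \<and> xs ! i < xs ! (i + 1) \<and> xs ! (i + 1) > (xs ! (i + 2) :: nat)}"
  have fin: "finite (?P xs)"
    by (rule finite_subset[of _ "{..<length xs}"]) auto
  have "?P (x # xs) = {i \<in> {0}. 2 \<le> length xs \<and> x < hd xs \<and> xs ! 1 < hd xs} \<union> Suc ` ?P xs"
    (is "?L = ?R")
  proof (rule set_eqI)
    fix i show "i \<in> ?L \<longleftrightarrow> i \<in> ?R"
      by (cases i; cases xs) (auto simp: image_iff Suc_le_eq)
  qed
  then have "pk (x # xs) =
      card ({i \<in> {0}. 2 \<le> length xs \<and> x < hd xs \<and> xs ! 1 < hd xs} \<union> Suc ` ?P xs)"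
    unfolding pk_def by (rule arg_cong)
  also have "\<dots> = card {i \<in> {0::nat}. 2 \<le> length xs \<and> x < hd xs \<and> xs ! 1 < hd xs} + card (Suc ` ?P xs)"
    using fin by (intro card_Un_disjoint) auto
  also have "card (Suc ` ?P xs) = pk xs"
    unfolding pk_def by (rule card_image) simp
  also have "{i \<in> {0::nat}. 2 \<le> length xs \<and> x < hd xs \<and> xs ! 1 < hd xs} =
      (if 2 \<le> length xs \<and> x < hd xs \<and> xs ! 1 < hd xs then {0} else {})"
    by simp
  finally show ?thesis
    by (simp split: if_splits)
qed

section \<open>Decomposition by the first entry\<close>

text \<open>The value set is arbitrary because removing the first entry of a permutation of
  \<open>{1..n}\<close> need not leave an initial segment.\<close>

definition few_perms :: "nat set \<Rightarrow> nat list set" where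
  "few_perms S = {xs \<in> permutations_of_set S. few_larger_right xs}"

lemma finite_few_perms [simp]: "finite (few_perms S)"
  by (simp add: few_perms_def)

lemma few_permsD:
  assumes "xs \<in> few_perms S"
  shows "set xs = S" "distinct xs" "length xs = card S"
  using assms
  by (auto simp: few_perms_def permutations_of_set_def distinct_card)

lemma few_perms_Cons_iff:
  "x # xs \<in> few_perms S \<longleftrightarrow> x \<in> S \<and> card {y \<in> S. x < y} \<le> 1 \<and> xs \<in> few_perms (S - {x})"
proof -
  have "card {y \<in> set xs. x < y} = card {y \<in> S. x < y}" if "set xs = S - {x}"
    using that by (intro arg_cong[of _ _ card]) auto
  moreover have "x # xs \<in> permutations_of_set S \<longleftrightarrow> x \<in> S \<and> xs \<in> permutations_of_set (S - {x})"
    by (auto simp: permutations_of_set_def)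
  ultimately show ?thesis
    by (auto simp: few_perms_def dest: permutations_of_setD)
qed

text \<open>Nothing exceeds \<open>Max S\<close>, so it may precede any admissible list of the other
  values. The predicate \<open>P\<close> will carry the peak count.\<close>

lemma few_perms_hd_Max:
  assumes "finite S" "S \<noteq> {}"
  shows "{xs \<in> few_perms S. hd xs = Max S \<and> P xs} =
    (#) (Max S) ` {xs \<in> few_perms (S - {Max S}). P (Max S # xs)}" (is "?L = ?R")
proof (rule set_eqI)
  fix xs
  have [simp]: "Max S \<in> S"
    using assms by simp
  have [simp]: "{y \<in> S. Max S < y} = {}"
    using assms by (auto simp: not_less)
  \<comment> \<open>\<open>hd []\<close> is unspecified, so the empty list must be excluded
    explicitly.\<close>
  have [simp]: "[] \<notin> few_perms S"
    using assms few_permsD(1)[of "[]" S] by auto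
  show "xs \<in> ?L \<longleftrightarrow> xs \<in> ?R"
    using assms by (cases xs) (auto simp: few_perms_Cons_iff)
qed

lemma second_Max:
  fixes S :: "nat set"
  assumes "finite S" "2 \<le> card S"
  defines "m \<equiv> Max (S - {Max S})"
  shows "m \<in> S" "m < Max S" "Max (S - {m}) = Max S"
    and "x \<in> S \<Longrightarrow> x \<noteq> Max S \<Longrightarrow> x \<le> m"
proof -
  have "S \<noteq> {Max S}" "S \<noteq> {}"
    using assms(2) by (auto dest: arg_cong[of _ _ card])
  then have "S - {Max S} \<noteq> {}"
    by blast
  then have m: "m \<in> S" "m \<noteq> Max S"
    using assms(1) Max_in[of "S - {Max S}"] unfolding m_def by blast+
  then show "m \<in> S" "m < Max S"
    using assms(1) by (simp_all add: le_neq_implies_less)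
  show "Max (S - {m}) = Max S"
    using assms(1) m \<open>S \<noteq> {}\<close> by (intro Max_eqI) auto
  show "x \<le> m" if "x \<in> S" "x \<noteq> Max S"
    using that assms(1) unfolding m_def by (intro Max_ge) auto
qed

text \<open>A first entry other than \<open>Max S\<close> already has \<open>Max S\<close> above it;
  allowing no further larger value forces it to be the second largest.\<close>

lemma few_perms_hd_not_Max:
  assumes "finite S" "2 \<le> card S"
  defines "m \<equiv> Max (S - {Max S})"
  shows "{xs \<in> few_perms S. hd xs \<noteq> Max S \<and> P xs} =
    (#) m ` {xs \<in> few_perms (S - {m}). P (m # xs)}" (is "?L = ?R")
proof (rule set_eqI)
  fix xs
  note m = second_Max[OF assms(1,2), folded m_def]
  have *: "card {y \<in> S. x < y} \<le> 1 \<longleftrightarrow> x = m" if "x \<in> S" "x \<noteq> Max S" for x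
  proof
    assume "card {y \<in> S. x < y} \<le> 1"
    then have "\<forall>y\<in>S. \<forall>z\<in>S. x < y \<longrightarrow> x < z \<longrightarrow> y = z"
      using assms by (auto simp: card_le_Suc0_iff_eq)
    moreover have "x < Max S" "Max S \<in> S"
      using that assms by (auto simp: le_neq_implies_less intro: Max_in)
    ultimately show "x = m"
      using m(1,2) m(4)[OF that] by (metis le_neq_implies_less less_irrefl)
  next
    assume "x = m"
    then have "{y \<in> S. x < y} \<subseteq> {Max S}"
      using m(4) by (auto simp: not_less[symmetric])
    then show "card {y \<in> S. x < y} \<le> 1"
      using card_mono[of "{Max S}"] by fastforce
  qed
  have [simp]: "[] \<notin> few_perms S"
    using m few_permsD(1)[of "[]" S] by auto
  show "xs \<in> ?L \<longleftrightarrow> xs \<in> ?R"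
    using m * by (cases xs) (auto simp: few_perms_Cons_iff)
qed

section \<open>Effect of the two possible first entries on the peaks\<close>

lemma pk_Cons_Max:
  assumes "xs \<in> few_perms (S - {Max S})" "finite S"
  shows "pk (Max S # xs) = pk xs"
proof -
  have "hd xs \<le> Max S" if "xs \<noteq> []"
    using assms few_permsD(1)[OF assms(1)] hd_in_set[OF that] by auto
  then show ?thesis
    by (cases xs) (auto simp: pk_Cons)
qed

text \<open>Only \<open>Max S\<close> exceeds \<open>m\<close>, so an ascent at the front means that
  \<open>xs\<close> starts with \<open>Max S\<close>. The bound \<open>3 \<le> card S\<close>
  provides the third entry of the peak.\<close>

lemma pk_Cons_second_Max:
  assumes "finite S" "2 \<le> card S"
  defines "m \<equiv> Max (S - {Max S})"
  assumes xs: "xs \<in> few_perms (S - {m})"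
  shows "pk (m # xs) = pk xs + (if 3 \<le> card S \<and> hd xs = Max (S - {m}) then 1 else 0)"
    and "Max (S - {m}) = Max S"
proof -
  note m = second_Max[OF assms(1,2), folded m_def]
  show M: "Max (S - {m}) = Max S"
    by (rule m)
  have S: "set xs = S - {m}" "distinct xs" "length xs = card S - 1"
    using few_permsD[OF xs] m assms(1) by auto
  then obtain y ys where xs_eq: "xs = y # ys"
    using assms(2) by (cases xs) auto
  have "m < y \<longleftrightarrow> y = Max S"
    using m(2) m(4)[of y] S(1) xs_eq by fastforce
  \<comment> \<open>The descent after the maximum is automatic; \<open>ys ! 0\<close> is
    \<open>xs ! 1\<close> in \<open>pk_Cons\<close>.\<close>
  moreover have "ys ! 0 < y" if "ys \<noteq> []" "y = Max S"
  proof -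
    have "ys ! 0 \<in> set ys" using that by simp
    then have "ys ! 0 \<in> S" "ys ! 0 \<noteq> y" using S(1,2) xs_eq by auto
    then show ?thesis using that assms(1) by (simp add: le_neq_implies_less)
  qed
  moreover have "3 \<le> card S \<longleftrightarrow> ys \<noteq> []"
    using S(3) assms(2) xs_eq by (cases ys) auto
  ultimately show "pk (m # xs) = pk xs + (if 3 \<le> card S \<and> hd xs = Max (S - {m}) then 1 else 0)"
    unfolding pk_Cons M by (auto simp: xs_eq Suc_le_eq)
qed

section \<open>Counting by Pascal's rule\<close>

text \<open>\<open>IH'\<close> needs \<open>n > 0\<close>: for a singleton, the only list starts
  with its maximum, whereas the formulas at \<open>n = 0\<close>, \<open>k = 0\<close> would give 0
  lists of that kind and 1 of the other.\<close>

lemma card_few_perms_pk_step: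
  assumes S: "card S = Suc (Suc n)"
    and IH: "\<And>T k. card T = Suc n \<Longrightarrow> card {xs \<in> few_perms T. pk xs = k} = Suc n choose (2 * k + 1)"
    and IH': "\<And>T k. card T = Suc n \<Longrightarrow> n > 0 \<Longrightarrow>
      card {xs \<in> few_perms T. hd xs = Max T \<and> pk xs = k} = n choose (2 * k + 1) \<and>
      card {xs \<in> few_perms T. hd xs \<noteq> Max T \<and> pk xs = k} = n choose (2 * k)"
  shows "card {xs \<in> few_perms S. hd xs = Max S \<and> pk xs = k} = Suc n choose (2 * k + 1)"
    and "card {xs \<in> few_perms S. hd xs \<noteq> Max S \<and> pk xs = k} = Suc n choose (2 * k)"
proof -
  have fin: "finite S" "S \<noteq> {}" "2 \<le> card S"
    using S by (auto intro: card_ge_0_finite)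
  define m where "m = Max (S - {Max S})"
  have cM: "card (S - {Max S}) = Suc n"
    using S fin by simp
  have "m \<in> S"
    using second_Max(1)[of S] fin by (simp add: m_def)
  then have cm: "card (S - {m}) = Suc n"
    using S fin by simp
  show "card {xs \<in> few_perms S. hd xs = Max S \<and> pk xs = k} = Suc n choose (2 * k + 1)"
  proof -
    have "card {xs \<in> few_perms S. hd xs = Max S \<and> pk xs = k} =
        card {xs \<in> few_perms (S - {Max S}). pk (Max S # xs) = k}"
      using fin by (simp add: few_perms_hd_Max card_image)
    also have "{xs \<in> few_perms (S - {Max S}). pk (Max S # xs) = k} =
        {xs \<in> few_perms (S - {Max S}). pk xs = k}"
      using fin by (auto simp: pk_Cons_Max)
    finally show ?thesis
      using IH[OF cM] by simp
  qed
  have "card {xs \<in> few_perms S. hd xs \<noteq> Max S \<and> pk xs = k} =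
      card {xs \<in> few_perms (S - {m}). pk (m # xs) = k}"
    using fin by (simp add: few_perms_hd_not_Max card_image m_def)
  also have "\<dots> = Suc n choose (2 * k)"
  proof (cases "n = 0")
    \<comment> \<open>With two values there is no room for a peak, and
      \<open>1 choose (2 * k + 1)\<close> equals \<open>1 choose (2 * k)\<close> for every
      \<open>k\<close>.\<close>
    case True
    then have "{xs \<in> few_perms (S - {m}). pk (m # xs) = k} = {xs \<in> few_perms (S - {m}). pk xs = k}"
      using fin S pk_Cons_second_Max(1)[of S, folded m_def] by auto
    then show ?thesis
      using IH[OF cm] True by (cases k) auto
  next
    case False
    let ?T = "S - {m}"
    have pk: "pk (m # xs) = pk xs + (if hd xs = Max ?T then 1 else 0)" if "xs \<in> few_perms ?T" for xs
      using pk_Cons_second_Max(1)[of S xs, folded m_def] fin S that False by auto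
    let ?A = "{xs \<in> few_perms ?T. hd xs \<noteq> Max ?T \<and> pk xs = k}"
    \<comment> \<open>Lists that gain a peak. Writing \<open>Suc (pk xs) = k\<close> makes this set
      empty for \<open>k = 0\<close>.\<close>
    let ?B = "{xs \<in> few_perms ?T. hd xs = Max ?T \<and> Suc (pk xs) = k}"
    have "{xs \<in> few_perms ?T. pk (m # xs) = k} = ?A \<union> ?B"
      using pk by auto
    then have "card {xs \<in> few_perms ?T. pk (m # xs) = k} = card (?A \<union> ?B)"
      by (rule arg_cong)
    also have "\<dots> = card ?A + card ?B"
      by (rule card_Un_disjoint) auto
    \<comment> \<open>For \<open>k > 0\<close> the summands are \<open>n choose (2 * k)\<close> and
      \<open>n choose (2 * k - 1)\<close>, so Pascal's rule applies.\<close>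
    also have "\<dots> = Suc n choose (2 * k)"
      using IH'[OF cm] False by (cases k) auto
    finally show ?thesis .
  qed
  finally show "card {xs \<in> few_perms S. hd xs \<noteq> Max S \<and> pk xs = k} = Suc n choose (2 * k)" .
qed

text \<open>The total and the refined counts are proved in one induction, since the step uses
  both.\<close>

lemma card_few_perms_pk:
  assumes "card S = Suc n"
  shows "card {xs \<in> few_perms S. pk xs = k} = Suc n choose (2 * k + 1) \<and>
    (n > 0 \<longrightarrow> card {xs \<in> few_perms S. hd xs = Max S \<and> pk xs = k} = n choose (2 * k + 1) \<and>
      card {xs \<in> few_perms S. hd xs \<noteq> Max S \<and> pk xs = k} = n choose (2 * k))"
  using assms
proof (induction n arbitrary: S k)
  case 0
  then obtain s where "S = {s}"
    by (auto simp: card_Suc_eq)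
  then have "few_perms S = {[s]}"
    by (auto simp: few_perms_def)
  then have "{xs \<in> few_perms S. pk xs = k} = {xs \<in> {[s]}. pk xs = k}"
    by (rule ssubst) (rule refl)
  also have "\<dots> = (if k = 0 then {[s]} else {})"
  proof -
    have "pk [s] = 0"
      by (simp add: pk_Cons)
    then show ?thesis
      by (cases "k = 0") auto
  qed
  finally show ?case
    by simp
next
  case (Suc n)
  have M: "card {xs \<in> few_perms S. hd xs = Max S \<and> pk xs = k} = Suc n choose (2 * k + 1)"
    by (rule card_few_perms_pk_step(1)[OF Suc.prems]) (use Suc.IH in simp_all)
  have N: "card {xs \<in> few_perms S. hd xs \<noteq> Max S \<and> pk xs = k} = Suc n choose (2 * k)"
    by (rule card_few_perms_pk_step(2)[OF Suc.prems]) (use Suc.IH in simp_all)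
  let ?A = "{xs \<in> few_perms S. hd xs = Max S \<and> pk xs = k}"
  let ?B = "{xs \<in> few_perms S. hd xs \<noteq> Max S \<and> pk xs = k}"
  have "{xs \<in> few_perms S. pk xs = k} = ?A \<union> ?B"
    by auto
  then have "card {xs \<in> few_perms S. pk xs = k} = card (?A \<union> ?B)"
    by (rule arg_cong)
  also have "\<dots> = (Suc n choose (2 * k + 1)) + (Suc n choose (2 * k))"
    unfolding M[symmetric] N[symmetric] by (rule card_Un_disjoint) auto
  \<comment> \<open>Pascal's rule merges the two refined counts into the total.\<close>
  finally show ?case
    using M N by simp
qed

theorem proposition17:
  fixes n k :: nat
  assumes "n \<ge> 1"
  shows "a_pk {[1, 2, 3], [1, 3, 2]} n k = n choose (2 * k + 1)"
proof -
  have "(\<forall>\<rho>\<in>{[1, 2, 3], [1, 3, 2]}. avoids_pattern xs \<rho>) \<longleftrightarrow> few_larger_right xs"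
    if "xs \<in> permutations_of_set {1..n}" for xs
    using that contains_123_or_132_iff[of xs] few_larger_right_iff[of xs]
    by (auto simp: avoids_pattern_def permutations_of_set_def)
  then have "{xs \<in> permutations_of_set {1..n}.
      (\<forall>\<rho>\<in>{[1, 2, 3], [1, 3, 2]}. avoids_pattern xs \<rho>) \<and> pk xs = k} =
      {xs \<in> few_perms {1..n}. pk xs = k}"
    unfolding few_perms_def by blast
  then show ?thesis
    \<comment> \<open>The count is stated for size \<open>Suc n\<close>, hence the instance
      \<open>n - 1\<close>, valid as \<open>n \<ge> 1\<close>.\<close>
    using card_few_perms_pk[of "{1..n}" "n - 1" k] assms by (simp add: a_pk_def)
qed

end
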